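(* Suppose $G$ is an $(r,t)$-RS graph on $n$ vertices. Then \[ r \leq \begin{cases} \dfrac{n}{4}\left(1+\dfrac{1}{t}\right) & \text{if $t$ is odd,}\\[2mm] \dfrac{n}{4}\left(1+\dfrac{1}{t+1}\right) & \text{if $t$ is even.} \end{cases} \] Moreover, these upper bounds on $r$ are tight for every positive integer $t$ and infinitely many $n$.
   Context: A graph $G$ is called an $(r,t)$-Ruzsa-Szemerédi graph (or $(r,t)$-RS graph) if its edge set can be partitioned into $t$ pairwise edge-disjoint induced matchings, each consisting of exactly $r$ edges. *)

theory Defs
  imports Complex_Main "HOL-Library.Disjoint_Sets"
begin

definition simple_graph :: "'a set \<Rightarrow> 'a set set \<Rightarrow> bool" where
  "simple_graph V E \<longleftrightarrow> finite V \<and> (\<forall>e\<in>E. e \<subseteq> V \<and> card e = 2)"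

definition induced_edges :: "'a set set \<Rightarrow> 'a set \<Rightarrow> 'a set set" where
  "induced_edges E W = {e \<in> E. e \<subseteq> W}"

definition matching :: "'a set set \<Rightarrow> 'a set set \<Rightarrow> bool" where
  "matching E M \<longleftrightarrow> M \<subseteq> E \<and> disjoint M"

definition induced_matching :: "'a set set \<Rightarrow> 'a set set \<Rightarrow> bool" where
  "induced_matching E M \<longleftrightarrow> matching E M \<and> induced_edges E (\<Union>M) = M"

text \<open>The \<open>t\<close> matchings form an indexed family, so the degenerate case
  \<open>r = 0\<close> (an edgeless graph, all matchings empty) is allowed for every \<open>t\<close>.\<close>

definition rs_graph :: "nat \<Rightarrow> nat \<Rightarrow> 'a set \<Rightarrow> 'a set set \<Rightarrow> bool" where
  "rs_graph r t V E \<longleftrightarrow>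
     simple_graph V E \<and>
     (\<exists>M :: nat \<Rightarrow> 'a set set.
        (\<forall>i<t. induced_matching E (M i) \<and> card (M i) = r) \<and>
        disjoint_family_on M {..<t} \<and>
        (\<Union>i<t. M i) = E)"

definition rs_bound :: "nat \<Rightarrow> nat \<Rightarrow> real" where
  "rs_bound n t =
     (if odd t then real n / 4 * (1 + 1 / real t)
      else real n / 4 * (1 + 1 / (real t + 1)))"

end

theory Submission
  imports Defs "HOL-Library.Nat_Bijection"
begin

text \<open>Let \<open>A i\<close> be the vertex set of the \<open>i\<close>-th matching, so \<open>|A i| = 2r\<close>. An edge of the \<open>i\<close>-th
  matching cannot lie inside \<open>A j\<close> for \<open>j \<noteq> i\<close>, so \<open>|A i \<inter> A j| \<le> r\<close>. Hence the sets \<open>A i\<close> together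
  with the empty set form a binary code of size \<open>t + 1\<close> with minimum distance at least \<open>2r\<close>, and the
  upper bound is the Plotkin bound.

  Equality holds when \<open>A i\<close>, for \<open>i < t\<close>, consists of the \<open>k+1\<close>-subsets of a \<open>2k+1\<close>-set that contain
  \<open>i\<close>, where \<open>k = t div 2\<close>. Taking these subsets \<open>S\<close> as vertices and joining two of them when they
  meet in the single point \<open>i\<close> gives the \<open>i\<close>-th matching: the partner of \<open>S\<close> must be
  \<open>insert i (- S)\<close>. Disjoint copies of the bipartite double cover of this graph (the double cover
  takes care of \<open>k = 0\<close>, where \<open>S\<close> would be its own partner) give infinitely many \<open>n\<close>.\<close>

text \<open>With \<open>k = t div 2\<close>, the odd and the even case become one formula, so
  \<open>t = 2 * k\<close> and \<open>t = 2 * k + 1\<close> share the same bound and the same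
  extremal graphs.\<close>

lemma rs_bound_half:
  "rs_bound n t = real n * real (t div 2 + 1) / (2 * real (2 * (t div 2) + 1))"
proof (cases "odd t")
  case True
  then obtain k where "t = 2 * k + 1" by (elim oddE)
  then show ?thesis by (simp add: rs_bound_def field_simps)
next
  case False
  then obtain k where "t = 2 * k" by (auto elim: evenE)
  then show ?thesis by (simp add: rs_bound_def field_simps)
qed

subsection \<open>The upper bound\<close>

text \<open>Two integers of given sum have the largest product when they are as equal as possible.
  With \<open>x = d - k - 1\<close> the gap is \<open>x * (x + 1)\<close> for odd \<open>s\<close>,
  nonnegative because \<open>x\<close> is an integer, and \<open>x * x\<close> for even
  \<open>s\<close>.\<close>

lemma balanced_product_le:
  fixes d k s :: int
  assumes "s = 2 * k + 1 \<or> s = 2 * k + 2"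
  shows "d * (s - d) \<le> (k + 1) * (s - 1 - k)"
proof -
  have pos: "0 \<le> x * (x + 1)" for x :: int
    by (cases "x \<ge> 0") (auto simp: mult_nonpos_nonpos)
  show ?thesis
    using assms pos[of "d - k - 1"] zero_le_square[of "d - k - 1"]
    by (auto simp: algebra_simps)
qed

text \<open>Double counting: of the pairs \<open>(v, i)\<close> with \<open>v\<close> in
  \<open>A i\<close>, and of the triples \<open>(v, i, j)\<close> with \<open>v\<close> in both
  \<open>A i\<close> and \<open>A j\<close>.\<close>

lemma sum_degree_squares:
  fixes A :: "nat \<Rightarrow> 'a set"
  assumes "finite V" "\<And>i. i < t \<Longrightarrow> A i \<subseteq> V"
  shows "(\<Sum>v\<in>V. int (card {i. i < t \<and> v \<in> A i})) = (\<Sum>i<t. int (card (A i)))"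
    and "(\<Sum>v\<in>V. (int (card {i. i < t \<and> v \<in> A i}))\<^sup>2) = (\<Sum>i<t. \<Sum>j<t. int (card (A i \<inter> A j)))"
proof -
  have deg: "int (card {i. i < t \<and> v \<in> A i}) = (\<Sum>i<t. of_bool (v \<in> A i))" for v
  proof -
    have "{i. i < t \<and> v \<in> A i} = {..<t} \<inter> {i. v \<in> A i}" by auto
    then show ?thesis by simp
  qed
  have card: "(\<Sum>v\<in>V. of_bool (v \<in> B)) = int (card B)" if "B \<subseteq> V" for B
    using that assms(1) by (simp add: Int_absorb1)
  have "(\<Sum>v\<in>V. int (card {i. i < t \<and> v \<in> A i})) = (\<Sum>i<t. \<Sum>v\<in>V. of_bool (v \<in> A i))"
    unfolding deg by (rule sum.swap)
  also have "\<dots> = (\<Sum>i<t. int (card (A i)))"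
    by (intro sum.cong refl card assms(2)) simp
  finally show "(\<Sum>v\<in>V. int (card {i. i < t \<and> v \<in> A i})) = (\<Sum>i<t. int (card (A i)))" .
  have "(\<Sum>v\<in>V. (int (card {i. i < t \<and> v \<in> A i}))\<^sup>2) =
      (\<Sum>v\<in>V. \<Sum>i<t. \<Sum>j<t. of_bool (v \<in> A i \<inter> A j))"
    unfolding deg power2_eq_square sum_product by (intro sum.cong refl) auto
  also have "\<dots> = (\<Sum>i<t. \<Sum>v\<in>V. \<Sum>j<t. of_bool (v \<in> A i \<inter> A j))"
    by (rule sum.swap)
  also have "\<dots> = (\<Sum>i<t. \<Sum>j<t. \<Sum>v\<in>V. of_bool (v \<in> A i \<inter> A j))"
    by (intro sum.cong refl sum.swap)
  also have "\<dots> = (\<Sum>i<t. \<Sum>j<t. int (card (A i \<inter> A j)))"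
    by (intro sum.cong refl card) (use assms(2) in auto)
  finally show "(\<Sum>v\<in>V. (int (card {i. i < t \<and> v \<in> A i}))\<^sup>2) =
      (\<Sum>i<t. \<Sum>j<t. int (card (A i \<inter> A j)))" .
qed

lemma plotkin_bound:
  fixes A :: "nat \<Rightarrow> 'a set"
  assumes V: "finite V" and A: "\<And>i. i < t \<Longrightarrow> A i \<subseteq> V"
    and size: "\<And>i. i < t \<Longrightarrow> card (A i) = 2 * r"
    and inter: "\<And>i j. i < t \<Longrightarrow> j < t \<Longrightarrow> i \<noteq> j \<Longrightarrow> card (A i \<inter> A j) \<le> r"
    and t: "t \<ge> 1"
  shows "real r \<le> rs_bound (card V) t"
proof -
  define k where "k = t div 2"
  define d where "d v = int (card {i. i < t \<and> v \<in> A i})" for v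
  have tk: "t = 2 * k \<or> t = 2 * k + 1" unfolding k_def by linarith
  have row: "(\<Sum>j<t. int (card (A i \<inter> A j))) \<le> int r * (int t + 1)" if i: "i < t" for i
  proof -
    have "(\<Sum>j<t. int (card (A i \<inter> A j))) \<le> (\<Sum>j<t. int r + (if j = i then int r else 0))"
      using inter size i by (intro sum_mono) auto
    also have "\<dots> = int r * (int t + 1)"
      using i by (simp add: sum.distrib algebra_simps)
    finally show ?thesis .
  qed
  have sq: "(\<Sum>v\<in>V. (d v)\<^sup>2) \<le> int t * (int r * (int t + 1))"
  proof -
    have "(\<Sum>v\<in>V. (d v)\<^sup>2) = (\<Sum>i<t. \<Sum>j<t. int (card (A i \<inter> A j)))"
      unfolding d_def by (rule sum_degree_squares(2)[OF V A])
    also have "\<dots> \<le> (\<Sum>i<t. int r * (int t + 1))"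
      by (intro sum_mono row) simp
    finally show ?thesis by simp
  qed
  have lin: "(\<Sum>v\<in>V. d v) = int t * (2 * int r)"
  proof -
    have "(\<Sum>v\<in>V. d v) = (\<Sum>i<t. int (card (A i)))"
      unfolding d_def by (rule sum_degree_squares(1)[OF V A])
    then show ?thesis using size by simp
  qed
  \<comment> \<open>Among the \<open>t + 1\<close> codewords (the \<open>A i\<close> and the empty
    set), \<open>d v\<close> contain \<open>v\<close>, so the summand counts the unordered pairs
    that differ at \<open>v\<close>. The sum is thus the total of all pairwise distances, each of
    which is at least \<open>2 * r\<close>.\<close>
  have "(\<Sum>v\<in>V. d v * (int t + 1 - d v)) = (int t + 1) * (\<Sum>v\<in>V. d v) - (\<Sum>v\<in>V. (d v)\<^sup>2)"
    by (simp add: sum_distrib_left sum_subtractf sum.distrib algebra_simps power2_eq_square)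
  then have "int r * int t * (int t + 1) \<le> (\<Sum>v\<in>V. d v * (int t + 1 - d v))"
    using sq unfolding lin by (simp add: algebra_simps)
  also have "\<dots> \<le> (\<Sum>v\<in>V. (int k + 1) * (int t + 1 - 1 - int k))"
    using tk by (intro sum_mono balanced_product_le) auto
  finally have main: "int r * int t * (int t + 1) \<le> int (card V) * ((int k + 1) * (int t - int k))"
    by simp
  have "2 * int r * (2 * int k + 1) \<le> int (card V) * (int k + 1)"
  \<comment> \<open>The common factor to cancel from \<open>main\<close> is \<open>k\<close> for
    even \<open>t\<close>, positive because \<open>t \<ge> 1\<close>, and \<open>k + 1\<close> for
    odd \<open>t\<close>.\<close>
  proof (cases "t = 2 * k")
    case True
    then have "int k * (2 * int r * (2 * int k + 1)) \<le> int k * (int (card V) * (int k + 1))"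
      using main by (simp add: algebra_simps)
    then show ?thesis using t True by (simp add: mult_le_cancel_left)
  next
    case False
    then have "(int k + 1) * (2 * int r * (2 * int k + 1)) \<le> (int k + 1) * (int (card V) * (int k + 1))"
      using main tk by (simp add: algebra_simps)
    then show ?thesis by (simp add: mult_le_cancel_left)
  qed
  then have "real_of_int (2 * int r * (2 * int k + 1)) \<le> real_of_int (int (card V) * (int k + 1))"
    by (rule of_int_le_iff[THEN iffD2])
  then show ?thesis
    unfolding rs_bound_half k_def[symmetric] by (simp add: field_simps)
qed

text \<open>\<open>plotkin_bound\<close> is applied to the vertex sets \<open>\<Union>(M i)\<close>.
  Each of the \<open>r\<close> edges of \<open>M i\<close> adds at most one vertex to the
  intersection with \<open>\<Union>(M j)\<close>, since an edge inside \<open>\<Union>(M j)\<close>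
  would belong to both matchings.\<close>

lemma rs_graph_le_rs_bound:
  assumes "rs_graph r t V E" "t \<ge> 1"
  shows "real r \<le> rs_bound (card V) t"
proof -
  from assms(1) obtain M where V: "finite V" and E: "\<And>e. e \<in> E \<Longrightarrow> e \<subseteq> V \<and> card e = 2"
    and M: "\<And>i. i < t \<Longrightarrow> induced_matching E (M i) \<and> card (M i) = r"
    and disj: "disjoint_family_on M {..<t}"
    unfolding rs_graph_def simple_graph_def by blast
  have ME: "M i \<subseteq> E" and Mdisj: "disjoint (M i)" and Mind: "induced_edges E (\<Union>(M i)) = M i"
    if "i < t" for i
    using M[OF that] by (auto simp: induced_matching_def matching_def)
  have finM: "finite (M i)" if "i < t" for i
    using V E ME[OF that] by (meson PowI finite_Pow_iff finite_subset subsetD subsetI)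
  have sub: "\<Union>(M i) \<subseteq> V" if "i < t" for i
    using E ME[OF that] by blast
  show ?thesis
  proof (rule plotkin_bound[OF V sub])
    fix i assume i: "i < t"
    have "card (\<Union>(M i)) = (\<Sum>e\<in>M i. card e)"
      using Mdisj[OF i] E ME[OF i] V by (intro card_Union_disjoint) (auto intro: finite_subset)
    also have "\<dots> = (\<Sum>e\<in>M i. 2)"
      using E ME[OF i] by (intro sum.cong) auto
    finally show "card (\<Union>(M i)) = 2 * r" using M[OF i] by simp
  next
    fix i j assume ij: "i < t" "j < t" "i \<noteq> j"
    have one: "card (e \<inter> \<Union>(M j)) \<le> 1" if e: "e \<in> M i" for e
    proof (rule ccontr)
      assume big: "\<not> ?thesis"
      have e2: "card e = 2" and eE: "e \<in> E" using E ME[OF ij(1)] e by auto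
      have "finite e" using e2 by (metis card.infinite zero_neq_numeral)
      then have "e \<inter> \<Union>(M j) = e" using big e2 by (intro card_seteq) auto
      then have "e \<in> induced_edges E (\<Union>(M j))" using eE by (auto simp: induced_edges_def)
      then have "e \<in> M j" using Mind[OF ij(2)] by simp
      then show False using disj ij e unfolding disjoint_family_on_def by blast
    qed
    have "\<Union>(M i) \<inter> \<Union>(M j) = (\<Union>e\<in>M i. e \<inter> \<Union>(M j))" by blast
    then have "card (\<Union>(M i) \<inter> \<Union>(M j)) \<le> (\<Sum>e\<in>M i. card (e \<inter> \<Union>(M j)))"
      using card_UN_le[OF finM[OF ij(1)], of "\<lambda>e. e \<inter> \<Union>(M j)"] by simp
    also have "\<dots> \<le> (\<Sum>e\<in>M i. 1)" by (intro sum_mono one)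
    finally show "card (\<Union>(M i) \<inter> \<Union>(M j)) \<le> r" using M[OF ij(1)] by simp
  qed (use assms(2) in auto)
qed

subsection \<open>The extremal construction\<close>

text \<open>The condition \<open>sep\<close> yields inducedness and edge-disjointness at once: an
  edge common to \<open>M i\<close> and \<open>M j\<close> also lies inside
  \<open>\<Union>(M j)\<close>.\<close>

lemma rs_graphI:
  assumes "finite V"
    and edge: "\<And>i e. i < t \<Longrightarrow> e \<in> M i \<Longrightarrow> e \<subseteq> V \<and> card e = 2"
    and "\<And>i. i < t \<Longrightarrow> disjoint (M i)"
    and "\<And>i. i < t \<Longrightarrow> card (M i) = r"
    and sep: "\<And>i j e. i < t \<Longrightarrow> j < t \<Longrightarrow> e \<in> M i \<Longrightarrow> e \<subseteq> \<Union>(M j) \<Longrightarrow> i = j"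
  shows "rs_graph r t V (\<Union>i<t. M i)"
proof -
  have "induced_edges (\<Union>i<t. M i) (\<Union>(M j)) = M j" if "j < t" for j
  proof (intro equalityI subsetI)
    fix e assume "e \<in> induced_edges (\<Union>i<t. M i) (\<Union>(M j))"
    then obtain i where i: "i < t" "e \<in> M i" "e \<subseteq> \<Union>(M j)" by (auto simp: induced_edges_def)
    then show "e \<in> M j" using sep[of i j e] that by simp
  qed (use that in \<open>auto simp: induced_edges_def\<close>)
  moreover have "disjoint_family_on M {..<t}"
    unfolding disjoint_family_on_def
  proof (intro ballI impI equals0I)
    fix i j e assume "i \<in> {..<t}" "j \<in> {..<t}" "i \<noteq> j" "e \<in> M i \<inter> M j"
    then show False using sep[of i j e] by auto
  qed
  ultimately show ?thesis
    using assms(1,3,4) edge unfolding rs_graph_def simple_graph_def induced_matching_def matching_def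
    by (intro conjI exI[of _ M]) auto
qed

lemma card_subsets_containing:
  assumes "finite U" "i \<in> U"
  shows "card {S. S \<subseteq> U \<and> card S = Suc k \<and> i \<in> S} = (card U - 1) choose k"
proof -
  have "bij_betw (insert i) {S. S \<subseteq> U - {i} \<and> card S = k} {S. S \<subseteq> U \<and> card S = Suc k \<and> i \<in> S}"
  proof (rule bij_betw_byWitness[where f' = "\<lambda>S. S - {i}"])
    show "insert i ` {S. S \<subseteq> U - {i} \<and> card S = k} \<subseteq> {S. S \<subseteq> U \<and> card S = Suc k \<and> i \<in> S}"
    proof safe
      fix S assume S: "S \<subseteq> U - {i}"
      then have "finite S" "i \<notin> S" using assms(1) by (auto intro: finite_subset)
      then show "card (insert i S) = Suc (card S)" by simp
    qed (use assms in auto)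
  qed auto
  then have "card {S. S \<subseteq> U \<and> card S = Suc k \<and> i \<in> S} = card {S. S \<subseteq> U - {i} \<and> card S = k}"
    by (rule bij_betw_same_card[symmetric])
  also have "\<dots> = (card U - 1) choose k"
    using assms by (simp add: n_subsets)
  finally show ?thesis .
qed

text \<open>The map \<open>v\<close> names the vertices inside \<open>'a\<close>: a subset, the
  number of the copy, and the side of the double cover. For \<open>t < 2 * k + 1\<close> the vertex
  set stays the same and the surplus matchings are dropped.\<close>

lemma rs_graph_middle_subsets:
  fixes v :: "nat set \<times> nat \<times> bool \<Rightarrow> 'a"
  assumes inj: "inj_on v ({S. finite S} \<times> UNIV \<times> UNIV)" and t: "t \<le> 2 * k + 1"
  shows "\<exists>(V :: 'a set) E. rs_graph (m * (2 * k choose k)) t V E \<and>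
    card V = 2 * m * (2 * k + 1 choose (k + 1))"
proof -
  define U where "U = {..<2 * k + 1}"
  define L where "L = {S. S \<subseteq> U \<and> card S = Suc k}"
  define p where "p i S = insert i (U - S)" for i :: nat and S
  define V where "V = v ` (L \<times> {..<m} \<times> UNIV)"
  \<comment> \<open>Edges are indexed by their endpoint on the \<open>False\<close> side, so each
    arises once. The sides keep the endpoints distinct even if \<open>p i S = S\<close>.\<close>
  define I where "I i = {S. S \<subseteq> U \<and> card S = Suc k \<and> i \<in> S} \<times> {..<m}" for i
  define e where "e i = (\<lambda>(S, x). {v (S, x, False), v (p i S, x, True)})" for i
  define M where "M i = e i ` I i" for i
  have U: "finite U" "card U = 2 * k + 1" by (auto simp: U_def)
  have fin: "finite S" if "S \<subseteq> U" for S using that U(1) by (rule finite_subset)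
  have v_eq: "v (S, x, b) = v (S', x', b') \<longleftrightarrow> S = S' \<and> x = x' \<and> b = b'"
    if "S \<subseteq> U" "S' \<subseteq> U" for S S' x x' b b'
    using inj_on_eq_iff[OF inj, of "(S, x, b)" "(S', x', b')"] fin that by simp
  have finL: "finite L" using U(1) by (auto simp: L_def)
  have p: "p i S \<subseteq> U" "card (p i S) = Suc k" "i \<in> p i S" "S \<inter> p i S = {i}" "p i (p i S) = S"
    if "S \<subseteq> U" "card S = Suc k" "i \<in> S" for i S
  proof -
    have "card (U - S) = k"
      using that U fin[OF that(1)] by (simp add: card_Diff_subset)
    then show "card (p i S) = Suc k" using that U by (simp add: p_def)
  qed (use that in \<open>auto simp: p_def\<close>)
  have p_eq: "p i S = p i S' \<longleftrightarrow> S = S'"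
    if "S \<subseteq> U" "card S = Suc k" "i \<in> S" "S' \<subseteq> U" "card S' = Suc k" "i \<in> S'" for i S S'
    using p(5) that by metis
  have "rs_graph (m * (2 * k choose k)) t V (\<Union>i<t. M i)"
  proof (rule rs_graphI)
    show "finite V" using finL by (simp add: V_def)
  next
    fix i f assume "f \<in> M i"
    then obtain S x where S: "S \<subseteq> U" "card S = Suc k" "i \<in> S" "x < m" "f = e i (S, x)"
      by (auto simp: M_def I_def)
    then show "f \<subseteq> V \<and> card f = 2"
      using p[OF S(1-3)] by (auto simp: e_def V_def L_def v_eq card_2_iff)
  next
    fix i
    show "disjoint (M i)"
    proof (rule disjointI)
      fix f g assume fg: "f \<in> M i" "g \<in> M i" "f \<noteq> g"
      then obtain S x S' x' where *: "S \<subseteq> U" "card S = Suc k" "i \<in> S" "f = e i (S, x)"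
        "S' \<subseteq> U" "card S' = Suc k" "i \<in> S'" "g = e i (S', x')"
        by (auto simp: M_def I_def)
      moreover have "\<not> (S = S' \<and> x = x')" using * fg(3) by auto
      ultimately show "f \<inter> g = {}"
        using p(1)[OF *(1-3)] p(1)[OF *(5-7)] p_eq[OF *(1-3) *(5-7)] by (auto simp: e_def v_eq)
    qed
  next
    fix i assume "i < t"
    then have i: "i \<in> U" using t by (simp add: U_def)
    have "inj_on (e i) (I i)"
      using p(1) by (intro inj_onI) (auto simp: I_def e_def doubleton_eq_iff v_eq)
    then have "card (M i) = card (I i)" unfolding M_def by (rule card_image)
    also have "\<dots> = m * (2 * k choose k)"
      using card_subsets_containing[OF U(1) i] U(2) by (simp add: I_def card_cartesian_product)
    finally show "card (M i) = m * (2 * k choose k)" .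
  next
    fix i j f assume f: "f \<in> M i" "f \<subseteq> \<Union>(M j)"
    then obtain S x where S: "S \<subseteq> U" "card S = Suc k" "i \<in> S" "f = e i (S, x)"
      by (auto simp: M_def I_def)
    \<comment> \<open>Every vertex covered by \<open>M j\<close> carries a set containing
      \<open>j\<close>, while the two sets of an edge of \<open>M i\<close> share only
      \<open>i\<close>.\<close>
    have j: "j \<in> R" if vR: "v (R, y, b) \<in> \<Union>(M j)" and R: "R \<subseteq> U" for R y b
    proof -
      obtain S' x' where S': "S' \<subseteq> U" "card S' = Suc k" "j \<in> S'" "v (R, y, b) \<in> e j (S', x')"
        using vR by (auto simp: M_def I_def)
      then show ?thesis using p(1,3)[OF S'(1-3)] R by (auto simp: e_def v_eq)
    qed
    have "j \<in> S \<inter> p i S"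
      using f(2) S j[of S x False] j[of "p i S" x True, OF _ p(1)[OF S(1-3)]] by (simp add: e_def)
    then show "i = j" using p(4)[OF S(1-3)] by simp
  qed
  moreover have "card V = 2 * m * (2 * k + 1 choose (k + 1))"
  proof -
    have "inj_on v (L \<times> {..<m} \<times> UNIV)"
      by (rule inj_on_subset[OF inj]) (auto simp: L_def fin)
    then have "card V = card (L \<times> {..<m} \<times> (UNIV :: bool set))" unfolding V_def by (rule card_image)
    also have "card L = (2 * k + 1 choose (k + 1))"
      using n_subsets[OF U(1), of "Suc k"] U(2) by (simp add: L_def)
    then have "card (L \<times> {..<m} \<times> (UNIV :: bool set)) = 2 * m * (2 * k + 1 choose (k + 1))"
      by (simp add: card_cartesian_product)
    finally show ?thesis .
  qed
  ultimately show ?thesis by blast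
qed

lemma infinite_rs_bound_attained:
  "infinite {n. \<exists>(V :: nat set) E r. rs_graph r t V E \<and> card V = n \<and> real r = rs_bound n t}"
    (is "infinite ?N")
proof -
  define k where "k = t div 2"
  \<comment> \<open>\<open>set_encode\<close> is injective only on finite sets, which is why
    injectivity of \<open>v\<close> is required only there.\<close>
  define v where "v = (\<lambda>(S, x, b). prod_encode (set_encode S, prod_encode (x, of_bool b)))"
  have inj: "inj_on v ({S. finite S} \<times> UNIV \<times> UNIV)"
    by (auto simp: inj_on_def v_def set_encode_eq of_bool_eq_iff)
  have t: "t \<le> 2 * k + 1" unfolding k_def by linarith
  define B where "B = (2 * k + 1 choose (k + 1))"
  have "2 * m * B \<in> ?N" for m
  proof -
    \<comment> \<open>This identity gives the ratio of \<open>r = m * (2 * k choose k)\<close> to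
      \<open>n = 2 * m * B\<close> as \<open>(k + 1) / (2 * (2 * k + 1))\<close> for
      \<open>m > 0\<close>, the factor in \<open>rs_bound_half\<close>.\<close>
    have "(k + 1) * B = (2 * k + 1) * (2 * k choose k)"
      using Suc_times_binomial[of k "2 * k"] by (simp add: B_def)
    then have "m * (2 * k choose k) * (2 * (2 * k + 1)) = 2 * m * B * (k + 1)"
      by algebra
    then have "real (m * (2 * k choose k)) * (2 * real (2 * k + 1)) = real (2 * m * B) * real (k + 1)"
      by (metis of_nat_mult of_nat_numeral)
    then have "real (m * (2 * k choose k)) = real (2 * m * B) * real (k + 1) / (2 * real (2 * k + 1))"
      by (simp add: nonzero_eq_divide_eq del: of_nat_mult)
    then have "real (m * (2 * k choose k)) = rs_bound (2 * m * B) t"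
      by (simp only: rs_bound_half k_def)
    then show ?thesis
      using rs_graph_middle_subsets[OF inj t, of m] unfolding B_def by blast
  qed
  moreover have "B > 0" by (simp add: B_def)
  then have "inj (\<lambda>m. 2 * m * B)" by (auto intro: injI)
  then have "infinite (range (\<lambda>m. 2 * m * B))" by (simp add: finite_image_iff)
  ultimately show ?thesis by (meson infinite_super image_subsetI)
qed

theorem theorem1p1:
  "(\<forall>(V :: 'a set) E n r t. t \<ge> 1 \<and> rs_graph r t V E \<and> card V = n
      \<longrightarrow> real r \<le> rs_bound n t) \<and>
   (\<forall>t\<ge>1. infinite {n. \<exists>(V :: nat set) E r.
      rs_graph r t V E \<and> card V = n \<and> real r = rs_bound n t})"
  using rs_graph_le_rs_bound infinite_rs_bound_attained by blast

end
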